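(* Let $X=[x_1,x_2]$ and $Y=[y_1,y_2]$ be in $\mathbb{IR}$. (1) If $x_1x_2>0$ or $y_1y_2>0$, then $\varphi(XY)=\varphi(X)\cdot\varphi(Y)$. (2) If $x_1x_2<0$ and $y_1y_2<0$, then $\varphi^{-1}(\varphi(XY))\subset\varphi^{-1}(\varphi(X)\cdot\varphi(Y))$ (inclusion of intervals).
   Context: $\mathbb{IR}$ is the set of intervals $[a,b]$ with real $a\le b$. The product of intervals is $XY=[\min S,\max S]$ with $S=\{x_1y_1,x_1y_2,x_2y_1,x_2y_2\}$. $\mathcal{A}_4$ is the 4-dimensional real commutative associative algebra with basis $e_1,e_2,e_3,e_4$ and product $e_1e_1=e_1$, $e_1e_4=e_4e_1=e_4$, $e_4e_4=e_1$, $e_2e_2=e_2$, $e_2e_3=e_3e_2=e_3$, $e_3e_3=e_2$, all other products of basis vectors being $0$; in coordinates, $x\cdot y=(x_1y_1+x_4y_4,\;x_2y_2+x_3y_3,\;x_3y_2+x_2y_3,\;x_4y_1+x_1y_4)$. The map $\varphi:\mathbb{IR}\to\mathcal{A}_4$ is defined for $X=[x_1,x_2]$ by $\varphi(X)=(x_1,x_2,0,0)$ if $x_1,x_2\ge 0$; $\varphi(X)=(0,x_2,-x_1,0)$ if $x_1\le 0$ and $x_2\ge 0$; $\varphi(X)=(0,0,-x_1,-x_2)$ if $x_1,x_2\le 0$. For $v\in\mathcal{A}_4$, $\varphi^{-1}(v)$ denotes the interval $Z$ with $\varphi(Z)=v$. *)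

theory Defs
  imports Complex_Main "HOL-Library.Interval"
begin

datatype A4 = A4 (co1: real) (co2: real) (co3: real) (co4: real)

lemma A4_eq_iff:
  "x = y \<longleftrightarrow> co1 x = co1 y \<and> co2 x = co2 y \<and> co3 x = co3 y \<and> co4 x = co4 y"
  by (cases x; cases y) simp

instantiation A4 :: comm_ring_1
begin

definition zero_A4 :: A4 where
  "0 = A4 0 0 0 0"

definition one_A4 :: A4 where
  "1 = A4 1 1 0 0"

definition plus_A4 :: "A4 \<Rightarrow> A4 \<Rightarrow> A4" where
  "x + y = A4 (co1 x + co1 y) (co2 x + co2 y) (co3 x + co3 y) (co4 x + co4 y)"

definition uminus_A4 :: "A4 \<Rightarrow> A4" where
  "- x = A4 (- co1 x) (- co2 x) (- co3 x) (- co4 x)"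

definition minus_A4 :: "A4 \<Rightarrow> A4 \<Rightarrow> A4" where
  "x - y = A4 (co1 x - co1 y) (co2 x - co2 y) (co3 x - co3 y) (co4 x - co4 y)"

definition times_A4 :: "A4 \<Rightarrow> A4 \<Rightarrow> A4" where
  "x * y = A4 (co1 x * co1 y + co4 x * co4 y)
              (co2 x * co2 y + co3 x * co3 y)
              (co3 x * co2 y + co2 x * co3 y)
              (co4 x * co1 y + co1 x * co4 y)"

instance
  by standard
    (simp_all add: A4_eq_iff zero_A4_def one_A4_def plus_A4_def uminus_A4_def minus_A4_def
      times_A4_def algebra_simps)

end

instantiation A4 :: real_algebra_1
begin

definition scaleR_A4 :: "real \<Rightarrow> A4 \<Rightarrow> A4" where
  "r *\<^sub>R x = A4 (r * co1 x) (r * co2 x) (r * co3 x) (r * co4 x)"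

instance
  by standard
    (simp_all add: A4_eq_iff plus_A4_def times_A4_def scaleR_A4_def algebra_simps)

end

definition e1 :: A4 where "e1 = A4 1 0 0 0"
definition e2 :: A4 where "e2 = A4 0 1 0 0"
definition e3 :: A4 where "e3 = A4 0 0 1 0"
definition e4 :: A4 where "e4 = A4 0 0 0 1"

lemma A4_basis: "A4 a b c d = a *\<^sub>R e1 + b *\<^sub>R e2 + c *\<^sub>R e3 + d *\<^sub>R e4"
  by (simp add: e1_def e2_def e3_def e4_def scaleR_A4_def plus_A4_def)

lemma A4_multiplication_table:
  "e1 * e1 = e1" "e1 * e4 = e4" "e4 * e1 = e4" "e4 * e4 = e1"
  "e2 * e2 = e2" "e2 * e3 = e3" "e3 * e2 = e3" "e3 * e3 = e2"
  "e1 * e2 = 0" "e2 * e1 = 0" "e1 * e3 = 0" "e3 * e1 = 0"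
  "e4 * e2 = 0" "e2 * e4 = 0" "e4 * e3 = 0" "e3 * e4 = 0"
  by (simp_all add: e1_def e2_def e3_def e4_def times_A4_def zero_A4_def)

(* The three cases overlap when an endpoint is 0; phi_nonneg, phi_mixed and phi_nonpos show
   that the order of the tests is immaterial. *)
definition \<phi> :: "real interval \<Rightarrow> A4" where
  "\<phi> X =
    (if 0 \<le> lower X \<and> 0 \<le> upper X then A4 (lower X) (upper X) 0 0
     else if lower X \<le> 0 \<and> 0 \<le> upper X then A4 0 (upper X) (- lower X) 0
     else A4 0 0 (- lower X) (- upper X))"

lemma phi_nonneg:
  "0 \<le> lower X \<Longrightarrow> 0 \<le> upper X \<Longrightarrow> \<phi> X = A4 (lower X) (upper X) 0 0"
  by (simp add: \<phi>_def)

lemma phi_mixed: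
  "lower X \<le> 0 \<Longrightarrow> 0 \<le> upper X \<Longrightarrow> \<phi> X = A4 0 (upper X) (- lower X) 0"
  by (simp add: \<phi>_def)

lemma phi_nonpos:
  "lower X \<le> 0 \<Longrightarrow> upper X \<le> 0 \<Longrightarrow> \<phi> X = A4 0 0 (- lower X) (- upper X)"
  by (simp add: \<phi>_def)

(* Hence the_inv \<phi> v is the unique Z with \<phi> Z = v whenever v lies in the range of \<phi>. *)
lemma inj_phi: "inj \<phi>"
proof (rule injI)
  fix X Y assume "\<phi> X = \<phi> Y"
  moreover have "lower X \<le> upper X" "lower Y \<le> upper Y" by simp_all
  ultimately show "X = Y"
    by (auto simp: \<phi>_def interval_eq_iff split: if_splits)
qed

end

theory Submission
  imports Defs
begin

text \<open>
  Negation of intervals corresponds to multiplication by \<open>J = e3 + e4\<close>, whose square is \<open>1\<close>. This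
  reduces the first claim to a nonnegative factor, where the endpoints of the product
  are explicit. For two intervals with zero in the interior, the second and third components of
  \<open>\<phi> X * \<phi> Y\<close> are sums of two nonnegative terms, where \<open>\<phi> (X * Y)\<close> has their maximum;
  hence only an inclusion.
\<close>

lemma interval_times_eq:
  fixes X Y :: "'a::linordered_idom interval"
  shows "lower (X * Y) = min (min (lower X * lower Y) (lower X * upper Y))
                             (min (upper X * lower Y) (upper X * upper Y))"
    and "upper (X * Y) = max (max (lower X * lower Y) (lower X * upper Y))
                             (max (upper X * lower Y) (upper X * upper Y))"
  by (simp_all add: lower_times upper_times min.assoc max.assoc)

lemma interval_times_commute: "X * Y = Y * X" for X Y :: "'a::linordered_idom interval"
  by (simp add: interval_eq_iff interval_times_eq mult.commute
      min.assoc max.assoc min.left_commute max.left_commute)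

lemma interval_minus_minus: "- (- X) = X" for X :: "'a::linordered_idom interval"
  by (simp add: interval_eq_iff)

lemma interval_minus_times:
  fixes X Y :: "'a::linordered_idom interval"
  shows "(- X) * Y = - (X * Y)"
  by (simp add: interval_eq_iff interval_times_eq minus_min_eq_max minus_max_eq_min
      min.commute max.commute min.left_commute max.left_commute)

text \<open>Multiplication by an element of a nonnegative \<open>X\<close> is monotone, so the lower
  end comes from \<open>lower Y\<close> and the upper end from \<open>upper Y\<close>; the sign of
  that endpoint decides which end of \<open>X\<close> is extremal.\<close>

lemma times_interval_nonneg:
  fixes X Y :: "'a::linordered_idom interval"
  assumes "0 \<le> lower X"
  shows "lower (X * Y) = (if 0 \<le> lower Y then lower X * lower Y else upper X * lower Y)"
    and "upper (X * Y) = (if 0 \<le> upper Y then upper X * upper Y else lower X * upper Y)"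
proof -
  have X: "lower X \<le> upper X" and Y: "lower Y \<le> upper Y" by simp_all
  have "lower X * lower Y \<le> lower X * upper Y" "upper X * lower Y \<le> upper X * upper Y"
    using order_trans[OF assms X] Y assms by (simp_all add: mult_left_mono)
  moreover have "(if 0 \<le> y then lower X * y \<le> upper X * y else upper X * y \<le> lower X * y)" for y
    using X by (simp add: mult_right_mono mult_right_mono_neg)
  note this[of "lower Y"] this[of "upper Y"]
  ultimately show
    "lower (X * Y) = (if 0 \<le> lower Y then lower X * lower Y else upper X * lower Y)"
    "upper (X * Y) = (if 0 \<le> upper Y then upper X * upper Y else lower X * upper Y)"
    using X Y by (auto simp: interval_times_eq min_def max_def simp del: lower_le_upper
        split: if_splits)
qed

text \<open>Multiplication by \<open>A4 0 0 1 1\<close>, that is \<open>e3 + e4\<close>, swaps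
  components 1 with 4 and 2 with 3, just as passing from [a, b] to [-b, -a] does under
  \<open>\<phi>\<close>.\<close>

lemma phi_uminus: "\<phi> (- X) = A4 0 0 1 1 * \<phi> X"
  using lower_le_upper[of X] by (auto simp: \<phi>_def times_A4_def simp del: lower_le_upper)

text \<open>Components 3 and 4 of \<open>\<phi> X\<close> vanish, so each component of
  \<open>\<phi> X * \<phi> Y\<close> is a single product of endpoints, and no sum can exceed the
  corresponding extremum.\<close>

lemma phi_times_nonneg:
  assumes "0 \<le> lower X"
  shows "\<phi> (X * Y) = \<phi> X * \<phi> Y"
proof -
  have X: "0 \<le> upper X" using assms lower_le_upper[of X] by linarith
  note ends = times_interval_nonneg[OF assms, of Y]
  have "lower Y \<le> upper Y" by simp
  then consider "0 \<le> lower Y" "0 \<le> upper Y" | "lower Y < 0" "0 \<le> upper Y"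
    | "lower Y < 0" "upper Y < 0" by linarith
  then show ?thesis
  proof cases
    case 1
    then show ?thesis using assms X by (simp add: phi_nonneg ends times_A4_def)
  next
    case 2
    then show ?thesis using assms X
      by (simp add: phi_nonneg phi_mixed ends times_A4_def mult_nonneg_nonpos)
  next
    case 3
    then show ?thesis using assms X
      by (simp add: phi_nonneg phi_nonpos ends times_A4_def mult_nonneg_nonpos)
  qed
qed

lemma phi_times_nonpos:
  assumes "upper X \<le> 0"
  shows "\<phi> (X * Y) = \<phi> X * \<phi> Y"
proof -
  have "\<phi> (X * Y) = \<phi> (- ((- X) * Y))" by (simp add: interval_minus_times interval_minus_minus)
  \<comment> \<open>The outer negation becomes a factor \<open>e3 + e4\<close>; once the nonnegative
    case has split the product, associativity attaches this factor to
    \<open>\<phi> (- X)\<close>.\<close>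
  also have "\<dots> = \<phi> (- (- X)) * \<phi> Y"
    using assms by (simp only: phi_uminus[of "- X * Y"] phi_uminus[of "- X"] mult.assoc
        phi_times_nonneg lower_uminus neg_0_le_iff_le)
  finally show ?thesis by (simp add: interval_minus_minus)
qed

lemma phi_times_definite:
  assumes "lower X * upper X > 0"
  shows "\<phi> (X * Y) = \<phi> X * \<phi> Y"
  using assms phi_times_nonneg[of X Y] phi_times_nonpos[of X Y]
  by (auto simp: zero_less_mult_iff)

lemma the_inv_phi: "the_inv \<phi> (\<phi> Z) = Z"
  by (rule the_inv_f_f[OF inj_phi])

lemma phi_times_indefinite:
  assumes "lower X * upper X < 0" "lower Y * upper Y < 0"
  obtains Z where "\<phi> Z = \<phi> X * \<phi> Y" "set_of (X * Y) \<subseteq> set_of Z"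
proof -
  have X: "lower X < 0" "0 < upper X" and Y: "lower Y < 0" "0 < upper Y"
    using assms lower_le_upper[of X] lower_le_upper[of Y]
    by (auto simp: mult_less_0_iff simp del: lower_le_upper)
  have signs: "0 \<le> lower X * lower Y" "lower X * upper Y \<le> 0"
    "upper X * lower Y \<le> 0" "0 \<le> upper X * upper Y"
    using X Y by (simp_all add: mult_nonpos_nonpos mult_nonpos_nonneg mult_nonneg_nonpos)
  \<comment> \<open>These are read off \<open>\<phi> X * \<phi> Y\<close> in the mixed case: its
    second component is \<open>u\<close>, its third is \<open>- l\<close>.\<close>
  define l u where "l = lower X * upper Y + upper X * lower Y"
    and "u = lower X * lower Y + upper X * upper Y"
  have lu: "l \<le> 0" "0 \<le> u" using signs by (simp_all add: l_def u_def)
  define Z where "Z = Interval (l, u)"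
  have Z: "lower Z = l" "upper Z = u" using lu by (simp_all add: Z_def lower.rep_eq upper.rep_eq Interval_inverse)
  show thesis
  proof
    show "\<phi> Z = \<phi> X * \<phi> Y"
      using X Y lu by (simp add: phi_mixed Z times_A4_def) (simp add: l_def u_def)
    \<comment> \<open>A sum of two nonpositive terms lies below their minimum, a sum of two
      nonnegative terms above their maximum.\<close>
    show "set_of (X * Y) \<subseteq> set_of Z"
      using signs by (auto simp: set_of_eq Z l_def u_def interval_times_eq)
  qed
qed

text \<open>Outside the range of \<open>\<phi>\<close> the value of \<open>the_inv \<phi>\<close>
  carries no information, so membership in the range is stated along with the inclusion.\<close>

theorem theorem18:
  fixes X Y :: "real interval"
  shows "(lower X * upper X > 0 \<or> lower Y * upper Y > 0 \<longrightarrow> \<phi> (X * Y) = \<phi> X * \<phi> Y) \<and>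
         (lower X * upper X < 0 \<and> lower Y * upper Y < 0 \<longrightarrow>
            \<phi> X * \<phi> Y \<in> range \<phi> \<and>
            set_of (the_inv \<phi> (\<phi> (X * Y))) \<subseteq> set_of (the_inv \<phi> (\<phi> X * \<phi> Y)))"
proof (intro conjI impI; (elim conjE)?)
  assume "lower X * upper X > 0 \<or> lower Y * upper Y > 0"
  then show "\<phi> (X * Y) = \<phi> X * \<phi> Y"
    using phi_times_definite[of X Y] phi_times_definite[of Y X] 
    by (auto simp: interval_times_commute[of Y X] mult.commute[of "\<phi> Y"])
next
  assume "lower X * upper X < 0" "lower Y * upper Y < 0"
  then obtain Z where "\<phi> Z = \<phi> X * \<phi> Y" "set_of (X * Y) \<subseteq> set_of Z"
    by (rule phi_times_indefinite)
  then show "\<phi> X * \<phi> Y \<in> range \<phi>"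
    and "set_of (the_inv \<phi> (\<phi> (X * Y))) \<subseteq> set_of (the_inv \<phi> (\<phi> X * \<phi> Y))"
    by (metis rangeI, metis the_inv_phi)
qed

end
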